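(* Let $\varphi$ be an analytic self-map of $\mathbb{D}$ and $\psi$ an analytic function on $\mathbb{D}$. The weighted composition operator $C_{\psi,\varphi}$ on $H^2$ is unitary and $J$-symmetric if and only if one of the following holds: (i) there are $p\in\mathbb{D}\setminus\{0\}$ and $c\in\mathbb{C}$ with $|c|=1$ such that $\psi(z)=c\,\frac{(1-|p|^2)^{1/2}}{1-\overline{p}z}$ and $\varphi(z)=\frac{\overline{p}}{p}\,\frac{p-z}{1-\overline{p}z}$; or (ii) there are $\mu,\lambda\in\mathbb{C}$ with $|\mu|=|\lambda|=1$ such that $\psi\equiv\mu$ and $\varphi(z)=\lambda z$.
   Context: $\mathbb{D}$ is the open unit disk and $H^2$ is the Hardy space on $\mathbb{D}$. For $\psi$ analytic on $\mathbb{D}$ and $\varphi$ an analytic self-map of $\mathbb{D}$, the weighted composition operator is $(C_{\psi,\varphi}f)(z)=\psi(z)f(\varphi(z))$. A conjugation is an isometric, antilinear involution $C$ on a complex Hilbert space; a bounded operator $T$ is $C$-symmetric (complex symmetric with conjugation $C$) if $CT^*C=T$. $J$ denotes the conjugation on $H^2$ given by $(Jf)(z)=\overline{f(\overline{z})}$. *)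

theory Defs
  imports "HOL-Complex_Analysis.Complex_Analysis"
begin

abbreviation unit_disk :: "complex set" (\<open>\<bbbD>\<close>)
  where "\<bbbD> \<equiv> ball 0 1"

abbreviation taylor_coeff :: "(complex \<Rightarrow> complex) \<Rightarrow> nat \<Rightarrow> complex"
  where "taylor_coeff f n \<equiv> fps_nth (fps_expansion f 0) n"

text \<open>
  A function on the disk is represented by its extension by zero to the whole plane, so that
  equality of elements of \<open>H2\<close> is equality of HOL functions.
\<close>

definition H2 :: "(complex \<Rightarrow> complex) set" where
  "H2 = {f. f holomorphic_on \<bbbD> \<and> (\<forall>z. z \<notin> \<bbbD> \<longrightarrow> f z = 0) \<and>
            summable (\<lambda>n. (cmod (taylor_coeff f n))\<^sup>2)}"

definition H2_inner :: "(complex \<Rightarrow> complex) \<Rightarrow> (complex \<Rightarrow> complex) \<Rightarrow> complex" where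
  "H2_inner f g = (\<Sum>n. taylor_coeff f n * cnj (taylor_coeff g n))"

definition H2_norm :: "(complex \<Rightarrow> complex) \<Rightarrow> real" where
  "H2_norm f = sqrt (Re (H2_inner f f))"

type_synonym operator = "(complex \<Rightarrow> complex) \<Rightarrow> (complex \<Rightarrow> complex)"

definition bounded_operator :: "operator \<Rightarrow> bool" where
  "bounded_operator T \<longleftrightarrow>
     (\<forall>f\<in>H2. T f \<in> H2) \<and>
     (\<forall>f\<in>H2. \<forall>g\<in>H2. T (\<lambda>z. f z + g z) = (\<lambda>z. T f z + T g z)) \<and>
     (\<forall>a. \<forall>f\<in>H2. T (\<lambda>z. a * f z) = (\<lambda>z. a * T f z)) \<and>
     (\<exists>M. \<forall>f\<in>H2. H2_norm (T f) \<le> M * H2_norm f)"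

text \<open>
  For bounded \<open>T\<close> the vector \<open>h\<close> exists by the Riesz representation theorem and is unique because
  the inner product is definite on \<open>H2\<close>; otherwise \<open>adj\<close> is unspecified.
\<close>

definition adj :: "operator \<Rightarrow> operator" where
  "adj T g = (THE h. h \<in> H2 \<and> (\<forall>f\<in>H2. H2_inner (T f) g = H2_inner f h))"

definition unitary_operator :: "operator \<Rightarrow> bool" where
  "unitary_operator T \<longleftrightarrow>
     bounded_operator T \<and> (\<forall>f\<in>H2. adj T (T f) = f \<and> T (adj T f) = f)"

definition conjugation :: "operator \<Rightarrow> bool" where
  "conjugation C \<longleftrightarrow>
     (\<forall>f\<in>H2. C f \<in> H2) \<and>
     (\<forall>f\<in>H2. \<forall>g\<in>H2. C (\<lambda>z. f z + g z) = (\<lambda>z. C f z + C g z)) \<and>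
     (\<forall>a. \<forall>f\<in>H2. C (\<lambda>z. a * f z) = (\<lambda>z. cnj a * C f z)) \<and>
     (\<forall>f\<in>H2. H2_norm (C f) = H2_norm f) \<and>
     (\<forall>f\<in>H2. C (C f) = f)"

definition symmetric_wrt :: "operator \<Rightarrow> operator \<Rightarrow> bool" where
  "symmetric_wrt C T \<longleftrightarrow>
     conjugation C \<and> bounded_operator T \<and> (\<forall>f\<in>H2. C (adj T (C f)) = T f)"

definition weighted_comp ::
    "(complex \<Rightarrow> complex) \<Rightarrow> (complex \<Rightarrow> complex) \<Rightarrow> operator" where
  "weighted_comp \<psi> \<phi> f = (\<lambda>z. if z \<in> \<bbbD> then \<psi> z * f (\<phi> z) else 0)"

definition J :: operator where
  "J f = (\<lambda>z. cnj (f (cnj z)))"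

lemma taylor_coeff_J:
  assumes "f holomorphic_on \<bbbD>"
  shows "taylor_coeff (J f) n = cnj (taylor_coeff f n)"
proof -
  have *: "(deriv ^^ n) (J f) z = cnj ((deriv ^^ n) f (cnj z))" if "z \<in> \<bbbD>" for z
    using that
  proof (induction n arbitrary: z)
    case 0
    then show ?case by (simp add: J_def)
  next
    case (Suc n)
    have "eventually (\<lambda>w. w \<in> \<bbbD>) (nhds z)"
      using Suc.prems by (intro eventually_nhds_in_open) auto
    then have "eventually (\<lambda>w. (deriv ^^ n) (J f) w = (cnj \<circ> (deriv ^^ n) f \<circ> cnj) w) (nhds z)"
      by (rule eventually_mono) (simp add: Suc.IH)
    then have "deriv ((deriv ^^ n) (J f)) z = deriv (cnj \<circ> (deriv ^^ n) f \<circ> cnj) z"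
      by (intro deriv_cong_ev) auto
    also have "\<dots> = cnj (deriv ((deriv ^^ n) f) (cnj z))"
    proof (rule DERIV_imp_deriv)
      have "(deriv ^^ n) f holomorphic_on \<bbbD>"
        by (intro holomorphic_higher_deriv assms) auto
      then have "((deriv ^^ n) f has_field_derivative deriv ((deriv ^^ n) f) (cnj z)) (at (cnj z))"
        using Suc.prems by (intro holomorphic_derivI[where S = "\<bbbD>"]) auto
      then show "((cnj \<circ> (deriv ^^ n) f \<circ> cnj) has_field_derivative
          cnj (deriv ((deriv ^^ n) f) (cnj z))) (at z)"
        using has_field_derivative_cnj_cnj by fastforce
    qed
    finally show ?case by simp
  qed
  show ?thesis
    using *[of 0] by (simp add: fps_expansion_def)
qed

lemma J_in_H2:
  assumes "f \<in> H2"
  shows "J f \<in> H2"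
proof -
  have hol: "f holomorphic_on \<bbbD>" using assms by (simp add: H2_def)
  have "cnj ` \<bbbD> = \<bbbD>"
    by (auto intro!: image_eqI[where x = "cnj _"])
  with hol have "J f holomorphic_on \<bbbD>"
    using holomorphic_on_compose_cnj_cnj[of f "\<bbbD>"] by (simp add: J_def o_def)
  with assms hol show ?thesis
    by (auto simp: H2_def taylor_coeff_J) (simp add: J_def)
qed

lemma conjugation_J: "conjugation J"
proof -
  have "H2_norm (J f) = H2_norm f" if "f \<in> H2" for f
    using that by (simp add: H2_norm_def H2_inner_def H2_def taylor_coeff_J mult.commute)
  then show ?thesis
    by (simp add: conjugation_def J_in_H2) (simp add: J_def)
qed

end

theory Submission
  imports Defs
begin

text \<open>
  Necessity: the adjoint sends the reproducing kernel \<open>K\<^sub>w\<close> to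
  \<open>\<psi>(w)\<^sup>* K\<^bsub>\<phi>(w)\<^esub>\<close>, so \<open>J\<close>-symmetry and unitarity become the two functional equations
  \<open>\<psi>(z) (1 - \<phi>(w) z) = \<psi>(w) (1 - w \<phi>(z))\<close> and
  \<open>\<psi>(z) \<psi>(w)\<^sup>* (1 - w\<^sup>* z) = 1 - \<phi>(w)\<^sup>* \<phi>(z)\<close>; the first already forces
  \<open>\<psi> = b / (1 - a z)\<close> and \<open>\<phi> = (a - k z) / (1 - a z)\<close>, and the second fixes the constants.

  Sufficiency: for a disk automorphism \<open>\<phi>\<close> vanishing at \<open>p\<close> and \<open>\<psi>\<close> the normalised kernel at \<open>p\<close>,
  multiplication by \<open>\<phi>\<close> preserves norms and \<open>\<psi>\<close> is orthogonal to every multiple of \<open>\<phi>\<close>. Hence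
  \<open>T = C\<^bsub>\<psi>,\<phi>\<^esub>\<close> is isometric on polynomials and, by passing to the limit in the Taylor coefficients, a
  contraction. The operator \<open>J T J\<close> is of the same kind and inverse to \<open>T\<close>, so both are isometric
  and \<open>J T J\<close> is the adjoint.
\<close>

subsection \<open>Square-summable power series\<close>

text \<open>This is \<open>H2\<close> without the condition of vanishing off the disk, so that
  explicit formulas such as \<open>mobius\<close> and \<open>weight\<close> can be used
  untruncated.\<close>

definition hardy :: "(complex \<Rightarrow> complex) set" where
  "hardy = {f. f holomorphic_on \<bbbD> \<and> summable (\<lambda>n. (cmod (taylor_coeff f n))\<^sup>2)}"

lemma hardyI:
  assumes "f holomorphic_on \<bbbD>" "summable (\<lambda>n. (cmod (taylor_coeff f n))\<^sup>2)"
  shows "f \<in> hardy"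
  using assms by (simp add: hardy_def)

lemma hardyD:
  assumes "f \<in> hardy"
  shows "f holomorphic_on \<bbbD>" "summable (\<lambda>n. (cmod (taylor_coeff f n))\<^sup>2)"
  using assms by (auto simp: hardy_def)

lemma H2_iff_hardy: "f \<in> H2 \<longleftrightarrow> f \<in> hardy \<and> (\<forall>z. z \<notin> \<bbbD> \<longrightarrow> f z = 0)"
  by (auto simp: H2_def hardy_def)

lemma H2_imp_hardy: "f \<in> H2 \<Longrightarrow> f \<in> hardy"
  by (simp add: H2_iff_hardy)

lemma taylor_coeff_eqI: "f has_fps_expansion F \<Longrightarrow> taylor_coeff f n = fps_nth F n"
  by (simp add: fps_expansion_eqI)

lemma holomorphic_disk_has_fps_expansion:
  "f holomorphic_on \<bbbD> \<Longrightarrow> f has_fps_expansion fps_expansion f 0"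
  by (rule has_fps_expansion_fps_expansion[of "\<bbbD>"]) auto

text \<open>Taylor coefficients at 0 see only the germ there. Hence membership in
  \<open>hardy\<close>, \<open>H2_inner\<close> and \<open>H2_norm\<close> do not distinguish a
  function from its truncation to the disk.\<close>

lemma fps_expansion_cong_disk:
  assumes "\<And>z. z \<in> \<bbbD> \<Longrightarrow> f z = g z"
  shows "fps_expansion f 0 = fps_expansion g 0"
proof (rule fps_expansion_cong)
  show "\<forall>\<^sub>F w in nhds 0. f w = g w"
    using eventually_nhds_in_open[of "\<bbbD>" 0] assms by (auto elim: eventually_mono)
qed

lemma hardy_cong:
  assumes "f \<in> hardy" "\<And>z. z \<in> \<bbbD> \<Longrightarrow> f z = g z"
  shows "g \<in> hardy"
proof -
  have "g holomorphic_on \<bbbD>"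
    using hardyD(1)[OF assms(1)] assms(2) by (rule holomorphic_transform)
  then show ?thesis
    using hardyD(2)[OF assms(1)] fps_expansion_cong_disk[of f g, OF assms(2)] by (simp add: hardy_def)
qed

lemma H2_inner_cong:
  assumes "\<And>z. z \<in> \<bbbD> \<Longrightarrow> f z = f' z" "\<And>z. z \<in> \<bbbD> \<Longrightarrow> g z = g' z"
  shows "H2_inner f g = H2_inner f' g'"
  unfolding H2_inner_def
  using fps_expansion_cong_disk[of f f', OF assms(1)] fps_expansion_cong_disk[of g g', OF assms(2)]
  by simp

lemma H2_norm_cong: "(\<And>z. z \<in> \<bbbD> \<Longrightarrow> f z = g z) \<Longrightarrow> H2_norm f = H2_norm g"
  unfolding H2_norm_def using H2_inner_cong[of f g f g] by simp

lemma taylor_coeff_add: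
  assumes "f holomorphic_on \<bbbD>" "g holomorphic_on \<bbbD>"
  shows "taylor_coeff (\<lambda>z. f z + g z) n = taylor_coeff f n + taylor_coeff g n"
  by (simp add: taylor_coeff_eqI[OF has_fps_expansion_add[OF
        holomorphic_disk_has_fps_expansion[OF assms(1)] holomorphic_disk_has_fps_expansion[OF assms(2)]]])

lemma taylor_coeff_cmult:
  assumes "f holomorphic_on \<bbbD>"
  shows "taylor_coeff (\<lambda>z. a * f z) n = a * taylor_coeff f n"
  by (simp add: taylor_coeff_eqI[OF has_fps_expansion_cmult_left[OF
        holomorphic_disk_has_fps_expansion[OF assms]]])

lemma taylor_coeff_mult_ident:
  assumes "f holomorphic_on \<bbbD>"
  shows "taylor_coeff (\<lambda>z. z * f z) n = (case n of 0 \<Rightarrow> 0 | Suc m \<Rightarrow> taylor_coeff f m)"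
  by (simp add: taylor_coeff_eqI[OF has_fps_expansion_mult[OF has_fps_expansion_fps_X
        holomorphic_disk_has_fps_expansion[OF assms]]] split: nat.split)

lemma taylor_coeff_sums:
  assumes "f holomorphic_on ball 0 R" "0 < R" "cmod z < R"
  shows "(\<lambda>n. taylor_coeff f n * z ^ n) sums f z"
proof (rule has_fps_expansion_imp_sums_complex)
  show "f has_fps_expansion fps_expansion f 0"
    using assms by (intro has_fps_expansion_fps_expansion[of "ball 0 R"]) auto
  show "f holomorphic_on eball 0 (ereal R)"
    using assms by simp
qed (use assms in auto)

lemma taylor_coeff_geometric: "taylor_coeff (\<lambda>z. 1 / (1 - a * z)) n = a ^ n"
proof -
  have "eventually (\<lambda>z. z \<in> {z. cmod (a * z) < 1}) (nhds 0)"
    by (intro eventually_nhds_in_open open_Collect_less continuous_intros) auto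
  then have "eventually (\<lambda>z. (\<lambda>n. fps_nth (Abs_fps (\<lambda>n. a ^ n)) n * z ^ n) sums (1 / (1 - a * z))) (nhds 0)"
    using geometric_sums[of "a * z" for z] by (auto elim!: eventually_mono simp: power_mult_distrib)
  then have "(\<lambda>z. 1 / (1 - a * z)) has_fps_expansion Abs_fps (\<lambda>n. a ^ n)"
    by (rule has_fps_expansionI)
  then show ?thesis
    by (simp add: taylor_coeff_eqI)
qed

lemma hardy_add:
  assumes "f \<in> hardy" "g \<in> hardy"
  shows "(\<lambda>z. f z + g z) \<in> hardy"
proof -
  have 1: "summable (\<lambda>n. 2 * (cmod (taylor_coeff f n))\<^sup>2 + 2 * (cmod (taylor_coeff g n))\<^sup>2)"
    using assms by (intro summable_add summable_mult hardyD)
  have 2: "(cmod (a + b))\<^sup>2 \<le> 2 * (cmod a)\<^sup>2 + 2 * (cmod b)\<^sup>2" for a b :: complex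
  proof -
    have "(cmod (a + b))\<^sup>2 \<le> (cmod a + cmod b)\<^sup>2"
      by (intro power_mono norm_triangle_ineq) auto
    also have "\<dots> \<le> 2 * (cmod a)\<^sup>2 + 2 * (cmod b)\<^sup>2"
      using sum_squares_bound[of "cmod a" "cmod b"] by (simp add: power2_sum)
    finally show ?thesis .
  qed
  have "summable (\<lambda>n. (cmod (taylor_coeff f n + taylor_coeff g n))\<^sup>2)"
    by (rule summable_comparison_test'[where N = 0, OF 1]) (use 2 in simp)
  then show ?thesis
    using assms by (intro hardyI) (auto simp: taylor_coeff_add hardyD intro: holomorphic_on_add)
qed

lemma hardy_cmult:
  assumes "f \<in> hardy"
  shows "(\<lambda>z. a * f z) \<in> hardy"
proof (rule hardyI)
  show "(\<lambda>z. a * f z) holomorphic_on \<bbbD>"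
    by (intro holomorphic_intros hardyD assms)
  show "summable (\<lambda>n. (cmod (taylor_coeff (\<lambda>z. a * f z) n))\<^sup>2)"
    using summable_mult[OF hardyD(2)[OF assms], of "(cmod a)\<^sup>2"]
    by (simp add: taylor_coeff_cmult[OF hardyD(1)[OF assms]] norm_mult power_mult_distrib)
qed

lemma hardy_mult_ident:
  assumes "f \<in> hardy"
  shows "(\<lambda>z. z * f z) \<in> hardy"
proof (rule hardyI)
  show "(\<lambda>z. z * f z) holomorphic_on \<bbbD>"
    by (intro holomorphic_intros hardyD assms)
  have "summable (\<lambda>n. (cmod (taylor_coeff (\<lambda>z. z * f z) (Suc n)))\<^sup>2)"
    using hardyD[OF assms] by (simp add: taylor_coeff_mult_ident)
  then show "summable (\<lambda>n. (cmod (taylor_coeff (\<lambda>z. z * f z) n))\<^sup>2)"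
    by (rule iffD1[OF summable_Suc_iff])
qed

text \<open>Convergence at a radius between 1 and \<open>R\<close> makes the coefficients absolutely
  summable; being eventually below 1, they dominate their squares.\<close>

lemma holomorphic_larger_disk_imp_hardy:
  assumes "f holomorphic_on ball 0 R" "R > 1"
  shows "f \<in> hardy"
proof -
  obtain r where r: "1 < r" "r < R"
    using assms(2) dense by blast
  have "summable (\<lambda>n. taylor_coeff f n * of_real r ^ n)"
    using taylor_coeff_sums[of f R "of_real r"] assms r by (auto simp: sums_iff)
  then have "summable (\<lambda>n. norm (taylor_coeff f n * 1 ^ n))"
    by (rule powser_insidea) (use r in simp)
  then have 1: "summable (\<lambda>n. cmod (taylor_coeff f n))"
    by simp
  have "eventually (\<lambda>n. cmod (taylor_coeff f n) < 1) sequentially"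
    using summable_LIMSEQ_zero[OF 1] by (rule order_tendstoD) simp
  then have "eventually (\<lambda>n. norm ((cmod (taylor_coeff f n))\<^sup>2) \<le> cmod (taylor_coeff f n)) sequentially"
    by (rule eventually_mono) (simp add: power2_eq_square mult_left_le)
  then have "summable (\<lambda>n. (cmod (taylor_coeff f n))\<^sup>2)"
    using 1 by (rule summable_comparison_test_ev)
  moreover have "f holomorphic_on \<bbbD>"
    using assms by (auto intro: holomorphic_on_subset)
  ultimately show ?thesis
    by (simp add: hardy_def)
qed

subsection \<open>The inner product\<close>

lemma H2_inner_summable:
  assumes "f \<in> hardy" "g \<in> hardy"
  shows "summable (\<lambda>n. taylor_coeff f n * cnj (taylor_coeff g n))"
proof (rule summable_comparison_test'[of _ 0])
  show "summable (\<lambda>n. (cmod (taylor_coeff f n))\<^sup>2 + (cmod (taylor_coeff g n))\<^sup>2)"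
    using assms by (intro summable_add hardyD)
  have "x * y \<le> x\<^sup>2 + y\<^sup>2" for x y :: real
    using sum_squares_bound[of x y] zero_le_power2[of x] zero_le_power2[of y] by linarith
  then show "norm (taylor_coeff f n * cnj (taylor_coeff g n))
      \<le> (cmod (taylor_coeff f n))\<^sup>2 + (cmod (taylor_coeff g n))\<^sup>2" for n
    by (simp add: norm_mult)
qed

lemma H2_inner_add_left:
  assumes "f \<in> hardy" "g \<in> hardy" "h \<in> hardy"
  shows "H2_inner (\<lambda>z. f z + g z) h = H2_inner f h + H2_inner g h"
  using assms by (simp add: H2_inner_def taylor_coeff_add hardyD distrib_right
      suminf_add H2_inner_summable)

lemma H2_inner_cmult_left:
  assumes "f \<in> hardy" "g \<in> hardy"
  shows "H2_inner (\<lambda>z. a * f z) g = a * H2_inner f g"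
  using assms by (simp add: H2_inner_def taylor_coeff_cmult hardyD mult.assoc
      suminf_mult H2_inner_summable)

lemma H2_inner_commute:
  assumes "f \<in> hardy" "g \<in> hardy"
  shows "H2_inner g f = cnj (H2_inner f g)"
proof -
  have "(\<lambda>n. cnj (taylor_coeff f n * cnj (taylor_coeff g n))) sums cnj (H2_inner f g)"
    unfolding H2_inner_def sums_cnj by (intro summable_sums H2_inner_summable assms)
  then show ?thesis
    by (simp add: H2_inner_def sums_iff mult.commute)
qed

lemma H2_inner_add_right:
  assumes "f \<in> hardy" "g \<in> hardy" "h \<in> hardy"
  shows "H2_inner h (\<lambda>z. f z + g z) = H2_inner h f + H2_inner h g"
  using H2_inner_commute[OF hardy_add[OF assms(1,2)] assms(3)] H2_inner_commute[OF assms(1,3)]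
    H2_inner_commute[OF assms(2,3)] H2_inner_add_left[OF assms]
  by (metis complex_cnj_add)

lemma H2_inner_cmult_right:
  assumes "f \<in> hardy" "g \<in> hardy"
  shows "H2_inner f (\<lambda>z. a * g z) = cnj a * H2_inner f g"
  using H2_inner_commute[OF hardy_cmult[OF assms(2)] assms(1)] H2_inner_commute[OF assms(2,1)]
    H2_inner_cmult_left[OF assms(2,1)]
  by (metis complex_cnj_mult)

text \<open>Multiplication by \<open>z\<close> shifts the coefficients by one and puts 0 in front,
  so the series is the same after its zero head term.\<close>

lemma H2_inner_mult_ident:
  assumes "f \<in> hardy" "g \<in> hardy"
  shows "H2_inner (\<lambda>z. z * f z) (\<lambda>z. z * g z) = H2_inner f g"
proof -
  let ?c = "\<lambda>n. taylor_coeff (\<lambda>z. z * f z) n * cnj (taylor_coeff (\<lambda>z. z * g z) n)"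
  have "summable ?c"
    by (intro H2_inner_summable hardy_mult_ident assms)
  then have "(\<Sum>n. ?c (Suc n)) = suminf ?c - ?c 0"
    by (rule suminf_split_head)
  then show ?thesis
    using assms unfolding H2_inner_def by (simp add: taylor_coeff_mult_ident hardyD)
qed

lemma H2_inner_self_sums:
  assumes "f \<in> hardy"
  shows "(\<lambda>n. (cmod (taylor_coeff f n))\<^sup>2) sums Re (H2_inner f f)"
  using sums_Re[OF summable_sums[OF H2_inner_summable[OF assms assms]]]
  by (simp add: H2_inner_def complex_norm_square[symmetric] del: of_real_power)

lemma H2_inner_self_nonneg:
  assumes "f \<in> hardy"
  shows "0 \<le> Re (H2_inner f f)"
  using sums_le[OF _ sums_zero H2_inner_self_sums[OF assms]] by simp

lemma H2_norm_nonneg: "f \<in> hardy \<Longrightarrow> 0 \<le> H2_norm f"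
  by (simp add: H2_norm_def H2_inner_self_nonneg)

lemma H2_norm_sq: "f \<in> hardy \<Longrightarrow> (H2_norm f)\<^sup>2 = Re (H2_inner f f)"
  by (simp add: H2_norm_def H2_inner_self_nonneg)

lemma H2_norm_sums: "f \<in> hardy \<Longrightarrow> (\<lambda>n. (cmod (taylor_coeff f n))\<^sup>2) sums (H2_norm f)\<^sup>2"
  by (simp add: H2_norm_sq H2_inner_self_sums)

lemma H2_norm_cmult:
  assumes "f \<in> hardy"
  shows "H2_norm (\<lambda>z. a * f z) = cmod a * H2_norm f"
proof -
  have "(H2_norm (\<lambda>z. a * f z))\<^sup>2 = (cmod a * H2_norm f)\<^sup>2"
    using sums_unique2[OF sums_mult[OF H2_norm_sums[OF assms], of "(cmod a)\<^sup>2"]]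
      H2_norm_sums[OF hardy_cmult[OF assms, of a]] assms
    by (simp add: taylor_coeff_cmult hardyD norm_mult power_mult_distrib)
  then show ?thesis
    using H2_norm_nonneg assms hardy_cmult by (simp add: power2_eq_iff_nonneg)
qed

lemma H2_norm_add_sq:
  assumes "f \<in> hardy" "g \<in> hardy"
  shows "(H2_norm (\<lambda>z. f z + g z))\<^sup>2 = (H2_norm f)\<^sup>2 + (H2_norm g)\<^sup>2 + 2 * Re (H2_inner f g)"
proof -
  have "Re (H2_inner g f) = Re (H2_inner f g)"
    by (subst H2_inner_commute[OF assms]) simp
  then show ?thesis
    using assms by (simp add: H2_norm_sq hardy_add H2_inner_add_left H2_inner_add_right)
qed

text \<open>The reproducing property: the conjugated coefficients of the kernel are
  \<open>p ^ n\<close>, so the inner product is the Taylor series of \<open>f\<close> at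
  \<open>p\<close>.\<close>

lemma H2_inner_geometric:
  assumes "f \<in> hardy" "p \<in> \<bbbD>"
  shows "H2_inner f (\<lambda>z. 1 / (1 - cnj p * z)) = f p"
  using taylor_coeff_sums[OF hardyD(1)[OF assms(1)], of p] assms(2)
  by (simp add: H2_inner_def taylor_coeff_geometric sums_iff)

subsection \<open>Contractivity of weighted composition operators\<close>

text \<open>A Fatou-type argument: a bound known on Taylor polynomials of \<open>f\<close> survives
  in the limit because every finite set of Taylor coefficients converges. Membership of the limit in
  \<open>hardy\<close> comes out of the same bound.\<close>

lemma weighted_comp_contraction:
  assumes \<phi>: "\<phi> holomorphic_on \<bbbD>" "\<phi> ` \<bbbD> \<subseteq> \<bbbD>" and \<psi>: "\<psi> holomorphic_on \<bbbD>"
    and f: "f \<in> hardy"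
    and poly: "\<And>N. (\<lambda>z. \<psi> z * (\<Sum>i<N. taylor_coeff f i * \<phi> z ^ i)) \<in> hardy"
      "\<And>N. (H2_norm (\<lambda>z. \<psi> z * (\<Sum>i<N. taylor_coeff f i * \<phi> z ^ i)))\<^sup>2
        \<le> (\<Sum>i<N. (cmod (taylor_coeff f i))\<^sup>2)"
  shows "(\<lambda>z. \<psi> z * f (\<phi> z)) \<in> hardy" "H2_norm (\<lambda>z. \<psi> z * f (\<phi> z)) \<le> H2_norm f"
proof -
  define t where "t N = (\<lambda>z. \<psi> z * (\<Sum>i<N. taylor_coeff f i * \<phi> z ^ i))" for N
  define g where "g = (\<lambda>z. \<psi> z * f (\<phi> z))"
  \<comment> \<open>Coefficients at 0 are determined near 0, so a disk with compact closure inside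
    \<bbbD> suffices; compactness bounds holomorphic functions on it.\<close>
  define A :: "complex set" where "A = ball 0 (1/2)"
  have sub: "cball 0 (1/2) \<subseteq> \<bbbD>" "A \<subseteq> cball 0 (1/2)" "A \<subseteq> \<bbbD>"
    by (auto simp: A_def)
  have comp: "(\<lambda>z. f (\<phi> z)) holomorphic_on \<bbbD>"
    using holomorphic_on_compose_gen[OF \<phi>(1) hardyD(1)[OF f] \<phi>(2)] by (simp add: o_def)
  have bdd: "bounded (h ` A)" if "h holomorphic_on \<bbbD>" for h :: "complex \<Rightarrow> complex"
  proof -
    have "compact (h ` cball 0 (1/2))"
      using that sub by (intro compact_continuous_image holomorphic_on_imp_continuous_on)
        (auto intro: holomorphic_on_subset)
    then show ?thesis
      using sub(2) by (meson bounded_subset compact_imp_bounded image_mono)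
  qed
  \<comment> \<open>The maximum \<open>r\<close> of \<open>cmod (\<phi> z)\<close> on the compact
    disk is below 1, so \<open>\<phi>\<close> maps \<open>A\<close> into a closed disk on which the
    Taylor series of \<open>f\<close> converges uniformly.\<close>
  have "continuous_on (cball 0 (1/2)) (\<lambda>z. cmod (\<phi> z))"
    by (intro continuous_intros holomorphic_on_imp_continuous_on holomorphic_on_subset[OF \<phi>(1) sub(1)])
  then obtain z0 where z0: "z0 \<in> cball 0 (1/2)" "\<And>z. z \<in> cball 0 (1/2) \<Longrightarrow> cmod (\<phi> z) \<le> cmod (\<phi> z0)"
    using continuous_attains_sup[of "cball 0 (1/2) :: complex set" "\<lambda>z. cmod (\<phi> z)"] by auto
  define r where "r = cmod (\<phi> z0)"
  have r1: "r < 1"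
    using \<phi>(2) z0(1) sub(1) by (auto simp: r_def image_subset_iff subset_iff)
  have "1 \<le> conv_radius (taylor_coeff f)"
    using conv_radius_fps_expansion[of f 0 1] hardyD(1)[OF f]
    by (simp add: fps_conv_radius_def one_ereal_def)
  moreover have "ereal r < 1"
    using r1 by (simp add: one_ereal_def)
  ultimately have "ereal r < conv_radius (taylor_coeff f)"
    by (rule less_le_trans[rotated])
  then have "uniform_limit (cball 0 r) (\<lambda>N x. \<Sum>i<N. taylor_coeff f i * x ^ i)
      (\<lambda>x. \<Sum>i. taylor_coeff f i * x ^ i) sequentially"
    using powser_uniform_limit[of r "taylor_coeff f" 0] by simp
  then have "uniform_limit A (\<lambda>N z. \<Sum>i<N. taylor_coeff f i * \<phi> z ^ i)
      (\<lambda>z. \<Sum>i. taylor_coeff f i * \<phi> z ^ i) sequentially"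
    by (rule uniform_limit_compose') (use z0(2) sub(2) in \<open>auto simp: r_def\<close>)
  moreover have "(\<Sum>i. taylor_coeff f i * \<phi> z ^ i) = f (\<phi> z)" if "z \<in> A" for z
    using taylor_coeff_sums[OF hardyD(1)[OF f], of "\<phi> z"] \<phi>(2) that sub(3)
    by (auto simp: sums_iff image_subset_iff subset_iff)
  ultimately have "uniform_limit A (\<lambda>N z. \<Sum>i<N. taylor_coeff f i * \<phi> z ^ i)
      (\<lambda>z. f (\<phi> z)) sequentially"
    using uniform_limit_cong'[where X = A] by (metis (no_types, lifting))
  \<comment> \<open>Multiplying by \<open>\<psi>\<close> keeps the convergence uniform since
    \<open>\<psi>\<close> and the limit are bounded on \<open>A\<close>.\<close>
  then have unif: "uniform_limit A t g sequentially"
    unfolding t_def g_def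
    by (intro uniform_lim_mult uniform_limit_const bdd comp \<psi>)
  have coeff: "(\<lambda>N. taylor_coeff (t N) k) \<longlonglongrightarrow> taylor_coeff g k" for k
  proof -
    have "(\<lambda>N. (deriv ^^ k) (t N) 0) \<longlonglongrightarrow> (deriv ^^ k) g 0"
    proof (rule higher_deriv_complex_uniform_limit[OF unif])
      show "\<forall>\<^sub>F N in sequentially. t N holomorphic_on A"
        using holomorphic_on_subset[OF hardyD(1)[OF poly(1)] sub(3)] by (simp add: t_def)
    qed (auto simp: A_def)
    then show ?thesis
      by (simp add: fps_expansion_def tendsto_divide)
  qed
  \<comment> \<open>The order of limits matters: \<open>K\<close> is fixed while \<open>N\<close>
    tends to infinity, and only afterwards is \<open>K\<close> released.\<close>
  have partial: "(\<Sum>k<K. (cmod (taylor_coeff g k))\<^sup>2) \<le> (H2_norm f)\<^sup>2" for K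
  proof (rule LIMSEQ_le_const2)
    show "(\<lambda>N. \<Sum>k<K. (cmod (taylor_coeff (t N) k))\<^sup>2) \<longlonglongrightarrow> (\<Sum>k<K. (cmod (taylor_coeff g k))\<^sup>2)"
      by (intro tendsto_intros coeff)
    have "(\<Sum>k<K. (cmod (taylor_coeff (t N) k))\<^sup>2) \<le> (H2_norm f)\<^sup>2" for N
    proof -
      have "(\<Sum>k<K. (cmod (taylor_coeff (t N) k))\<^sup>2) \<le> (H2_norm (t N))\<^sup>2"
        using H2_norm_sums[OF poly(1)[of N]] sum_le_suminf[of "\<lambda>k. (cmod (taylor_coeff (t N) k))\<^sup>2" "{..<K}"]
        by (simp add: t_def sums_iff)
      also have "\<dots> \<le> (\<Sum>i<N. (cmod (taylor_coeff f i))\<^sup>2)"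
        using poly(2) by (simp add: t_def)
      also have "\<dots> \<le> (H2_norm f)\<^sup>2"
        using H2_norm_sums[OF f] sum_le_suminf[of "\<lambda>k. (cmod (taylor_coeff f k))\<^sup>2" "{..<N}"]
        by (simp add: sums_iff)
      finally show ?thesis .
    qed
    then show "\<exists>M. \<forall>N\<ge>M. (\<Sum>k<K. (cmod (taylor_coeff (t N) k))\<^sup>2) \<le> (H2_norm f)\<^sup>2"
      by blast
  qed
  have "summable (\<lambda>k. (cmod (taylor_coeff g k))\<^sup>2)"
    using partial by (rule summableI_nonneg_bounded[rotated]) simp
  moreover have "g holomorphic_on \<bbbD>"
    unfolding g_def by (intro holomorphic_intros comp \<psi>)
  ultimately have g: "g \<in> hardy"
    by (intro hardyI)
  then show "(\<lambda>z. \<psi> z * f (\<phi> z)) \<in> hardy"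
    by (simp add: g_def)
  have "(H2_norm g)\<^sup>2 \<le> (H2_norm f)\<^sup>2"
    using suminf_le_const[OF hardyD(2)[OF g] partial] H2_norm_sums[OF g] by (simp add: sums_iff)
  then show "H2_norm (\<lambda>z. \<psi> z * f (\<phi> z)) \<le> H2_norm f"
    unfolding g_def by (rule power2_le_imp_le) (rule H2_norm_nonneg[OF f])
qed

subsection \<open>Disk automorphisms\<close>

text \<open>For \<open>p\<close> in the disk and unimodular \<open>\<eta>\<close> this is the
  general disk automorphism, with zero \<open>p\<close>. The value \<open>p = 0\<close> gives the
  rotation \<open>- \<eta> * z\<close>, so both cases of the theorem have this form.\<close>

definition mobius :: "complex \<Rightarrow> complex \<Rightarrow> complex \<Rightarrow> complex" where
  "mobius \<eta> p z = \<eta> * ((p - z) / (1 - cnj p * z))"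

text \<open>The reproducing kernel at \<open>p\<close> divided by its norm, times a scalar; for
  \<open>p = 0\<close> it is the constant \<open>c\<close>.\<close>

definition weight :: "complex \<Rightarrow> complex \<Rightarrow> complex \<Rightarrow> complex" where
  "weight c p z = c * (complex_of_real (sqrt (1 - (cmod p)\<^sup>2)) / (1 - cnj p * z))"

lemma one_minus_cnj_mult_nonzero:
  assumes "cmod p * cmod z < 1"
  shows "1 - cnj p * z \<noteq> 0"
proof
  assume "1 - cnj p * z = 0"
  then have "cmod (cnj p * z) = 1"
    by (metis eq_iff_diff_eq_0 norm_one)
  with assms show False
    by (simp add: norm_mult)
qed

lemma one_minus_cnj_mult_nonzero_disk:
  assumes "p \<in> \<bbbD>" "z \<in> \<bbbD>"
  shows "1 - cnj p * z \<noteq> 0"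
proof (rule one_minus_cnj_mult_nonzero)
  have "cmod p * cmod z \<le> cmod p * 1"
    using assms by (intro mult_left_mono) auto
  then show "cmod p * cmod z < 1"
    using assms by simp
qed

text \<open>
  Both sides expand to \<open>(1 + \<bar>p\<bar>\<^sup>2) \<parallel>g\<parallel>\<^sup>2 - 2 Re (p \<langle>g, z g\<rangle>)\<close>, which is why multiplication by a
  Blaschke factor preserves the norm.
\<close>

lemma H2_norm_mult_diff_eq:
  assumes "g \<in> hardy"
  shows "H2_norm (\<lambda>z. (p - z) * g z) = H2_norm (\<lambda>z. (1 - cnj p * z) * g z)"
proof -
  define h where "h = (\<lambda>z. z * g z)"
  have h: "h \<in> hardy"
    unfolding h_def by (rule hardy_mult_ident[OF assms])
  have eq: "H2_norm h = H2_norm g"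
    unfolding h_def H2_norm_def using H2_inner_mult_ident[OF assms assms] by simp
  have gh: "Re (H2_inner (\<lambda>z. p * g z) (\<lambda>z. (- 1) * h z)) = Re (- (p * H2_inner g h))"
    using assms h by (simp only: H2_inner_cmult_left H2_inner_cmult_right hardy_cmult) simp
  have gh': "Re (H2_inner g (\<lambda>z. (- cnj p) * h z)) = Re (- (p * H2_inner g h))"
    using assms h by (simp only: H2_inner_cmult_right) simp
  have "(H2_norm (\<lambda>z. p * g z + (- 1) * h z))\<^sup>2 = (H2_norm (\<lambda>z. g z + (- cnj p) * h z))\<^sup>2"
    using assms h
    by (simp only: H2_norm_add_sq hardy_cmult gh gh' H2_norm_cmult eq) (simp add: power_mult_distrib)
  then have "H2_norm (\<lambda>z. p * g z + (- 1) * h z) = H2_norm (\<lambda>z. g z + (- cnj p) * h z)"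
    using power2_eq_imp_eq H2_norm_nonneg hardy_add hardy_cmult assms h by meson
  then show ?thesis
    by (simp add: h_def algebra_simps)
qed

context
  fixes p \<eta> c :: complex
  assumes p: "p \<in> \<bbbD>" and \<eta>: "cmod \<eta> = 1" and c: "cmod c = 1"
begin

text \<open>A radius with \<open>R > 1\<close> and \<open>cmod p * R < 1\<close>: the pole of the
  automorphism and of the weight stays outside \<open>ball 0 R\<close>, so everything built from
  them is holomorphic past the closed unit disk.\<close>

private definition R :: real where "R = 2 / (1 + cmod p)"

private lemma R: "R > 1" "z \<in> ball 0 R \<Longrightarrow> 1 - cnj p * z \<noteq> 0"
proof -
  have "0 < 1 + cmod p"
    by (simp add: add_pos_nonneg)
  then show "R > 1"
    using p unfolding R_def by (simp add: less_divide_eq)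
  show "1 - cnj p * z \<noteq> 0" if "z \<in> ball 0 R"
  proof (rule one_minus_cnj_mult_nonzero)
    have "cmod p * cmod z \<le> cmod p * R"
      using that by (intro mult_left_mono) auto
    also have "\<dots> < 1"
      using p norm_ge_zero[of p] unfolding R_def by (simp add: field_simps add_pos_nonneg)
    finally show "cmod p * cmod z < 1" .
  qed
qed

private lemma holomorphic_mobius: "mobius \<eta> p holomorphic_on ball 0 R"
  unfolding mobius_def by (intro holomorphic_intros) (use R in auto)

private lemma holomorphic_weight: "weight c p holomorphic_on ball 0 R"
  unfolding weight_def by (intro holomorphic_intros) (use R in auto)

text \<open>Dividing \<open>f\<close> by \<open>1 - cnj p * z\<close> reduces this to the equality
  of the norms of \<open>(p - z) * g\<close> and \<open>(1 - cnj p * z) * g\<close>.\<close>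

private lemma H2_norm_mobius_mult:
  assumes "f holomorphic_on ball 0 R"
  shows "H2_norm (\<lambda>z. mobius \<eta> p z * f z) = H2_norm f"
proof -
  define g where "g = (\<lambda>z. f z / (1 - cnj p * z))"
  have "g holomorphic_on ball 0 R"
    unfolding g_def by (intro holomorphic_intros assms) (use R in auto)
  then have g: "g \<in> hardy"
    using R by (blast intro: holomorphic_larger_disk_imp_hardy)
  have pg: "(\<lambda>z. (p - z) * g z) \<in> hardy"
    using hardy_add[OF hardy_cmult[OF g, of p] hardy_cmult[OF hardy_mult_ident[OF g], of "-1"]]
    by (simp add: algebra_simps)
  have "H2_norm (\<lambda>z. mobius \<eta> p z * f z) = H2_norm (\<lambda>z. \<eta> * ((p - z) * g z))"
    by (rule H2_norm_cong) (simp add: mobius_def g_def)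
  also have "\<dots> = H2_norm (\<lambda>z. (p - z) * g z)"
    using pg \<eta> by (simp add: H2_norm_cmult)
  also have "\<dots> = H2_norm (\<lambda>z. (1 - cnj p * z) * g z)"
    by (rule H2_norm_mult_diff_eq[OF g])
  also have "\<dots> = H2_norm f"
    using one_minus_cnj_mult_nonzero_disk[OF p] by (intro H2_norm_cong) (simp add: g_def)
  finally show ?thesis .
qed

private lemma weight_hardy: "weight c p \<in> hardy"
  by (rule holomorphic_larger_disk_imp_hardy[OF holomorphic_weight R(1)])

text \<open>Pairing with the weight is evaluation at \<open>p\<close> up to a scalar; in particular
  functions vanishing at \<open>p\<close> are orthogonal to it.\<close>

private lemma H2_inner_weight:
  assumes "f \<in> hardy"
  shows "H2_inner f (weight c p) = cnj c * sqrt (1 - (cmod p)\<^sup>2) * f p"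
proof -
  have "(\<lambda>z. 1 / (1 - cnj p * z)) \<in> hardy"
    by (rule holomorphic_larger_disk_imp_hardy[OF _ R(1)]) (intro holomorphic_intros, use R in auto)
  moreover have "weight c p = (\<lambda>z. (c * sqrt (1 - (cmod p)\<^sup>2)) * (1 / (1 - cnj p * z)))"
    by (auto simp: weight_def)
  ultimately show ?thesis
    using H2_inner_geometric[OF assms p] assms by (simp add: H2_inner_cmult_right del: times_divide_eq_right)
qed

private lemma H2_norm_weight: "(H2_norm (weight c p))\<^sup>2 = 1"
proof -
  have p1: "(cmod p)\<^sup>2 < 1"
    using p by (simp add: power_less_one_iff)
  define s where "s = complex_of_real (sqrt (1 - (cmod p)\<^sup>2))"
  have s: "s * s = 1 - cnj p * p" "s \<noteq> 0"
    using p1 by (simp_all add: s_def complex_norm_square[symmetric] mult.commute flip: of_real_mult)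
  then have w: "weight c p p = c / s"
    by (simp add: weight_def s_def[symmetric] flip: s(1))
  have "H2_inner (weight c p) (weight c p) = cnj c * c"
    using s(2) by (simp add: H2_inner_weight[OF weight_hardy] w s_def[symmetric])
  then show ?thesis
    using c by (simp add: H2_norm_sq[OF weight_hardy] complex_norm_square[symmetric] mult.commute)
qed

private lemma weight_mobius_poly:
  "(\<lambda>z. weight c p z * (\<Sum>i<N. a i * mobius \<eta> p z ^ i)) holomorphic_on ball 0 R"
  by (intro holomorphic_intros holomorphic_weight holomorphic_mobius)

text \<open>The products of the weight with powers of \<open>mobius \<eta> p\<close> are
  orthonormal. The induction peels off the constant term as in Horner's scheme: the rest is
  \<open>mobius \<eta> p\<close> times a polynomial \<open>t\<close> of the same kind with shifted
  coefficients, hence orthogonal to the weight and of the same norm as \<open>t\<close>.\<close>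

private lemma H2_norm_weight_mobius_poly:
  "(H2_norm (\<lambda>z. weight c p z * (\<Sum>i<N. a i * mobius \<eta> p z ^ i)))\<^sup>2 = (\<Sum>i<N. (cmod (a i))\<^sup>2)"
proof (induction N arbitrary: a)
  case 0
  then show ?case
    using H2_norm_cmult[OF weight_hardy, of 0] by simp
next
  case (Suc N)
  define t where "t = (\<lambda>z. weight c p z * (\<Sum>i<N. a (Suc i) * mobius \<eta> p z ^ i))"
  have t: "t holomorphic_on ball 0 R"
    unfolding t_def by (rule weight_mobius_poly)
  have bt: "(\<lambda>z. mobius \<eta> p z * t z) \<in> hardy"
    by (rule holomorphic_larger_disk_imp_hardy[OF _ R(1)]) (intro holomorphic_intros holomorphic_mobius t)
  have "H2_inner (\<lambda>z. mobius \<eta> p z * t z) (weight c p) = 0"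
    unfolding H2_inner_weight[OF bt] by (simp add: mobius_def)
  then have orth: "H2_inner (\<lambda>z. a 0 * weight c p z) (\<lambda>z. mobius \<eta> p z * t z) = 0"
    using H2_inner_commute[OF bt weight_hardy] bt by (simp add: H2_inner_cmult_left weight_hardy)
  have "(\<lambda>z. weight c p z * (\<Sum>i<Suc N. a i * mobius \<eta> p z ^ i))
      = (\<lambda>z. a 0 * weight c p z + mobius \<eta> p z * t z)"
    unfolding sum.lessThan_Suc_shift t_def
    by (simp add: sum_distrib_left algebra_simps)
  then have "(H2_norm (\<lambda>z. weight c p z * (\<Sum>i<Suc N. a i * mobius \<eta> p z ^ i)))\<^sup>2
      = (cmod (a 0))\<^sup>2 + (H2_norm t)\<^sup>2"
    using bt
    by (simp add: H2_norm_add_sq hardy_cmult weight_hardy orth H2_norm_cmult power_mult_distrib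
        H2_norm_weight H2_norm_mobius_mult[OF t])
  also have "\<dots> = (\<Sum>i<Suc N. (cmod (a i))\<^sup>2)"
    unfolding sum.lessThan_Suc_shift t_def using Suc.IH[of "\<lambda>i. a (Suc i)"] by simp
  finally show ?case .
qed

lemma mobius_contraction:
  assumes "mobius \<eta> p ` \<bbbD> \<subseteq> \<bbbD>" "f \<in> hardy"
  shows "(\<lambda>z. weight c p z * f (mobius \<eta> p z)) \<in> hardy"
    "H2_norm (\<lambda>z. weight c p z * f (mobius \<eta> p z)) \<le> H2_norm f"
proof -
  have sub: "\<bbbD> \<subseteq> ball 0 R"
    using R(1) by auto
  show "(\<lambda>z. weight c p z * f (mobius \<eta> p z)) \<in> hardy"
    "H2_norm (\<lambda>z. weight c p z * f (mobius \<eta> p z)) \<le> H2_norm f"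
    by (rule weighted_comp_contraction[OF holomorphic_on_subset[OF holomorphic_mobius sub] assms(1)
          holomorphic_on_subset[OF holomorphic_weight sub] assms(2)];
        simp add: holomorphic_larger_disk_imp_hardy[OF weight_mobius_poly R(1)]
          H2_norm_weight_mobius_poly)+
qed

end

subsection \<open>Unitary operators from pairs of mutually inverse contractions\<close>

lemma H2_add: "f \<in> H2 \<Longrightarrow> g \<in> H2 \<Longrightarrow> (\<lambda>z. f z + g z) \<in> H2"
  by (simp add: H2_iff_hardy hardy_add)

lemma H2_cmult: "f \<in> H2 \<Longrightarrow> (\<lambda>z. a * f z) \<in> H2"
  by (simp add: H2_iff_hardy hardy_cmult)

text \<open>The reproducing kernel at \<open>w\<close>, set to 0 off the disk so that it is an
  element of \<open>H2\<close>.\<close>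

definition kernel :: "complex \<Rightarrow> complex \<Rightarrow> complex" where
  "kernel w z = (if z \<in> \<bbbD> then 1 / (1 - cnj w * z) else 0)"

lemma kernel_in_H2:
  assumes "w \<in> \<bbbD>"
  shows "kernel w \<in> H2"
proof -
  have "summable (\<lambda>n. ((cmod w)\<^sup>2) ^ n)"
    using assms by (intro summable_geometric) (simp add: power_less_one_iff)
  moreover have "((cmod w)\<^sup>2) ^ n = (cmod (taylor_coeff (\<lambda>z. 1 / (1 - cnj w * z)) n))\<^sup>2" for n
    unfolding taylor_coeff_geometric by (simp add: norm_power mult.commute flip: power_mult)
  ultimately have "summable (\<lambda>n. (cmod (taylor_coeff (\<lambda>z. 1 / (1 - cnj w * z)) n))\<^sup>2)"
    by simp
  moreover have "(\<lambda>z. 1 / (1 - cnj w * z)) holomorphic_on \<bbbD>"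
    by (intro holomorphic_intros one_minus_cnj_mult_nonzero_disk[OF assms])
  ultimately have "(\<lambda>z. 1 / (1 - cnj w * z)) \<in> hardy"
    by (intro hardyI)
  then have "kernel w \<in> hardy"
    by (rule hardy_cong) (simp add: kernel_def)
  then show ?thesis
    by (simp add: H2_iff_hardy kernel_def)
qed

lemma H2_inner_kernel:
  assumes "f \<in> hardy" "w \<in> \<bbbD>"
  shows "H2_inner f (kernel w) = f w"
  unfolding H2_inner_geometric[OF assms, symmetric]
  by (rule H2_inner_cong) (simp_all add: kernel_def)

text \<open>Testing against kernels recovers all values on the disk. This is the uniqueness behind
  the description in \<open>adj\<close>.\<close>

lemma H2_eqI:
  assumes "g \<in> H2" "h \<in> H2" "\<And>f. f \<in> H2 \<Longrightarrow> H2_inner f g = H2_inner f h"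
  shows "g = h"
proof
  fix z
  show "g z = h z"
  proof (cases "z \<in> \<bbbD>")
    case True
    have "H2_inner (kernel z) f = cnj (f z)" if "f \<in> H2" for f
      using H2_inner_commute[of f "kernel z"] H2_inner_kernel[of f z] kernel_in_H2[OF True] True that
      by (simp add: H2_imp_hardy)
    then show ?thesis
      using assms(3)[OF kernel_in_H2[OF True]] assms(1,2) by simp
  next
    case False
    then show ?thesis
      using assms(1,2) by (simp add: H2_iff_hardy)
  qed
qed

lemma adj_eqI:
  assumes "h \<in> H2" "\<And>f. f \<in> H2 \<Longrightarrow> H2_inner (T f) g = H2_inner f h"
  shows "adj T g = h"
  unfolding adj_def
proof (rule the_equality)
  fix k assume k: "k \<in> H2 \<and> (\<forall>f\<in>H2. H2_inner (T f) g = H2_inner f k)"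
  show "k = h"
    by (rule H2_eqI) (use k assms in auto)
qed (use assms in auto)

text \<open>Polarisation: expanding the norm of a sum gives the real parts, and replacing
  \<open>f\<close> by \<open>\<i> * f\<close> gives the imaginary parts.\<close>

lemma H2_inner_isometry:
  assumes maps: "\<And>f. f \<in> H2 \<Longrightarrow> T f \<in> H2"
    and add: "\<And>f g. f \<in> H2 \<Longrightarrow> g \<in> H2 \<Longrightarrow> T (\<lambda>z. f z + g z) = (\<lambda>z. T f z + T g z)"
    and scale: "\<And>a f. f \<in> H2 \<Longrightarrow> T (\<lambda>z. a * f z) = (\<lambda>z. a * T f z)"
    and iso: "\<And>f. f \<in> H2 \<Longrightarrow> H2_norm (T f) = H2_norm f"
    and f: "f \<in> H2" and g: "g \<in> H2"
  shows "H2_inner (T f) (T g) = H2_inner f g"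
proof -
  have Re: "Re (H2_inner (T h) (T g)) = Re (H2_inner h g)" if h: "h \<in> H2" for h
    using iso[OF H2_add[OF h g]] iso[OF h] iso[OF g] h g maps
      H2_norm_add_sq[of h g] H2_norm_add_sq[of "T h" "T g"]
    by (simp add: add H2_imp_hardy)
  have "Re (\<i> * H2_inner (T f) (T g)) = Re (\<i> * H2_inner f g)"
    using Re[OF H2_cmult[OF f, of \<i>]] f g maps
    by (simp add: scale H2_inner_cmult_left H2_imp_hardy)
  then show ?thesis
    using Re[OF f] by (simp add: complex_eq_iff)
qed

lemma weighted_comp_add: "weighted_comp \<psi> \<phi> (\<lambda>z. f z + g z) = (\<lambda>z. weighted_comp \<psi> \<phi> f z + weighted_comp \<psi> \<phi> g z)"
  by (auto simp: weighted_comp_def algebra_simps)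

lemma weighted_comp_cmult: "weighted_comp \<psi> \<phi> (\<lambda>z. a * f z) = (\<lambda>z. a * weighted_comp \<psi> \<phi> f z)"
  by (auto simp: weighted_comp_def algebra_simps)

lemma weighted_comp_cong:
  assumes "\<And>z. z \<in> \<bbbD> \<Longrightarrow> \<psi> z = \<psi>' z" "\<And>z. z \<in> \<bbbD> \<Longrightarrow> \<phi> z = \<phi>' z"
  shows "weighted_comp \<psi> \<phi> = weighted_comp \<psi>' \<phi>'"
  using assms by (auto simp: weighted_comp_def fun_eq_iff)

text \<open>From \<open>f = S (T f)\<close> the norm of \<open>f\<close> is at most that of
  \<open>T f\<close>, so \<open>T\<close> is isometric. Writing \<open>g = T (S g)\<close> and
  cancelling \<open>T\<close> in the inner product identifies \<open>S\<close> as the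
  adjoint.\<close>

lemma weighted_comp_inverse_contractions:
  fixes \<psi> \<phi> :: "complex \<Rightarrow> complex" and S :: operator
  defines "T \<equiv> weighted_comp \<psi> \<phi>"
  assumes T: "\<And>f. f \<in> H2 \<Longrightarrow> T f \<in> H2" "\<And>f. f \<in> H2 \<Longrightarrow> H2_norm (T f) \<le> H2_norm f"
    and S: "\<And>f. f \<in> H2 \<Longrightarrow> S f \<in> H2" "\<And>f. f \<in> H2 \<Longrightarrow> H2_norm (S f) \<le> H2_norm f"
    and inv: "\<And>f. f \<in> H2 \<Longrightarrow> S (T f) = f" "\<And>f. f \<in> H2 \<Longrightarrow> T (S f) = f"
  shows "bounded_operator T" "\<And>g. g \<in> H2 \<Longrightarrow> adj T g = S g" "unitary_operator T"
proof -
  show bounded: "bounded_operator T"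
    unfolding bounded_operator_def
  proof (intro conjI ballI allI exI[of _ 1])
    show "H2_norm (T f) \<le> 1 * H2_norm f" if "f \<in> H2" for f
      using T(2)[OF that] by simp
  qed (simp_all add: T(1)[unfolded T_def] T_def weighted_comp_add weighted_comp_cmult)
  have iso: "H2_norm (T f) = H2_norm f" if "f \<in> H2" for f
    using T(2)[OF that] S(2)[OF T(1)[OF that]] inv(1)[OF that] by simp
  show adj: "adj T g = S g" if g: "g \<in> H2" for g
  proof (rule adj_eqI)
    fix f assume f: "f \<in> H2"
    have "H2_inner (T f) (T (S g)) = H2_inner f (S g)"
      by (rule H2_inner_isometry[OF T(1) _ _ iso f S(1)[OF g]])
        (simp_all add: T_def weighted_comp_add weighted_comp_cmult)
    then show "H2_inner (T f) g = H2_inner f (S g)"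
      by (simp add: inv(2) g)
  qed (rule S(1)[OF g])
  show "unitary_operator T"
    using bounded T(1) inv by (simp add: unitary_operator_def adj)
qed

subsection \<open>Sufficiency\<close>

text \<open>Together with \<open>weight_cnj\<close> this says that conjugating all parameters turns
  the operator \<open>T\<close> into \<open>J T J\<close>.\<close>

lemma mobius_cnj: "mobius (cnj \<eta>) (cnj p) z = cnj (mobius \<eta> p (cnj z))"
  by (simp add: mobius_def)

lemma weight_cnj: "weight (cnj c) (cnj p) z = cnj (weight c p (cnj z))"
  by (simp add: weight_def)

text \<open>The inverse of \<open>mobius \<eta> p\<close> is
  \<open>mobius (cnj \<eta>) (\<eta> * p)\<close>, and \<open>\<eta> * p = cnj p\<close> makes it
  the map with conjugated parameters.\<close>

lemma mobius_cnj_inverse: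
  assumes p: "p \<in> \<bbbD>" and \<eta>: "cmod \<eta> = 1" "\<eta> * p = cnj p" and c: "cmod c = 1" and z: "z \<in> \<bbbD>"
  shows "mobius (cnj \<eta>) (cnj p) (mobius \<eta> p z) = z"
    "weight c p z * weight (cnj c) (cnj p) (mobius \<eta> p z) = 1"
proof -
  define d where "d = 1 - cnj p * z"
  define q where "q = 1 - cnj p * p"
  define w where "w = mobius \<eta> p z"
  define s where "s = complex_of_real (sqrt (1 - (cmod p)\<^sup>2))"
  have nz: "d \<noteq> 0" "q \<noteq> 0"
    unfolding d_def q_def using one_minus_cnj_mult_nonzero_disk p z by auto
  have p1: "(cmod p)\<^sup>2 < 1"
    using p by (simp add: power_less_one_iff)
  have s: "s * s = q"
    using p1 by (simp add: s_def q_def complex_norm_square[symmetric] mult.commute flip: of_real_mult)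
  have unit: "cnj \<eta> * \<eta> = 1" "cnj c * c = 1"
    using \<eta> c by (simp_all add: complex_norm_square[symmetric] mult.commute)
  have w: "w * d = \<eta> * (p - z)"
    using nz by (simp add: w_def mobius_def d_def)
  have "(1 - p * w) * d = d - p * (w * d)"
    by (simp add: algebra_simps)
  also have "\<dots> = d - (\<eta> * p) * (p - z)"
    by (simp add: w)
  also have "\<dots> = q"
    unfolding \<eta> by (simp add: d_def q_def algebra_simps)
  finally have den: "1 - p * w = q / d"
    using nz by (simp add: field_simps)
  have "(cnj p - w) * d = cnj p * d - w * d"
    by (simp add: algebra_simps)
  also have "\<dots> = (\<eta> * p) * d - \<eta> * (p - z)"
    by (simp add: w \<eta>)
  also have "\<dots> = \<eta> * z * q"
    by (simp add: d_def q_def algebra_simps)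
  finally have num: "cnj p - w = \<eta> * z * q / d"
    using nz by (simp add: field_simps)
  have "mobius (cnj \<eta>) (cnj p) w = cnj \<eta> * \<eta> * z"
    using nz by (simp add: mobius_def den num)
  then show "mobius (cnj \<eta>) (cnj p) (mobius \<eta> p z) = z"
    by (simp add: unit w_def)
  \<comment> \<open>The denominators are \<open>d\<close> and \<open>q / d\<close>, so
    \<open>d\<close> cancels and \<open>s * s = q\<close> remains in the numerator.\<close>
  have "weight c p z * weight (cnj c) (cnj p) w = (cnj c * c) * (s * s) / q"
    using nz by (simp add: weight_def den flip: s_def d_def)
  then show "weight c p z * weight (cnj c) (cnj p) (mobius \<eta> p z) = 1"
    using nz by (simp add: unit s flip: w_def)
qed

lemma weighted_comp_cnj_inverse:
  assumes "p \<in> \<bbbD>" "cmod \<eta> = 1" "\<eta> * p = cnj p" "cmod c = 1"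
    and "mobius \<eta> p ` \<bbbD> \<subseteq> \<bbbD>" and "f \<in> H2"
  shows "weighted_comp (weight c p) (mobius \<eta> p)
    (weighted_comp (weight (cnj c) (cnj p)) (mobius (cnj \<eta>) (cnj p)) f) = f"
proof
  fix z
  show "weighted_comp (weight c p) (mobius \<eta> p)
    (weighted_comp (weight (cnj c) (cnj p)) (mobius (cnj \<eta>) (cnj p)) f) z = f z"
  proof (cases "z \<in> \<bbbD>")
    case True
    then have "mobius \<eta> p z \<in> \<bbbD>"
      using assms(5) by blast
    then show ?thesis
      using mobius_cnj_inverse[OF assms(1-4) True] True
      by (simp add: weighted_comp_def flip: mult.assoc)
  next
    case False
    then show ?thesis
      using assms(6) by (simp add: weighted_comp_def H2_iff_hardy)
  qed
qed

lemma weighted_comp_mobius_H2: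
  assumes "p \<in> \<bbbD>" "cmod \<eta> = 1" "cmod c = 1" "mobius \<eta> p ` \<bbbD> \<subseteq> \<bbbD>" "f \<in> H2"
  shows "weighted_comp (weight c p) (mobius \<eta> p) f \<in> H2"
    "H2_norm (weighted_comp (weight c p) (mobius \<eta> p) f) \<le> H2_norm f"
proof -
  note contr = mobius_contraction[OF assms(1-4) H2_imp_hardy[OF assms(5)]]
  have "weighted_comp (weight c p) (mobius \<eta> p) f \<in> hardy"
    by (rule hardy_cong[OF contr(1)]) (simp add: weighted_comp_def)
  then show "weighted_comp (weight c p) (mobius \<eta> p) f \<in> H2"
    by (simp add: H2_iff_hardy weighted_comp_def)
  have "H2_norm (weighted_comp (weight c p) (mobius \<eta> p) f)
      = H2_norm (\<lambda>z. weight c p z * f (mobius \<eta> p z))"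
    by (rule H2_norm_cong) (simp add: weighted_comp_def)
  then show "H2_norm (weighted_comp (weight c p) (mobius \<eta> p) f) \<le> H2_norm f"
    using contr(2) by simp
qed

lemma weighted_comp_mobius_unitary_symmetric:
  assumes p: "p \<in> \<bbbD>" and \<eta>: "cmod \<eta> = 1" "\<eta> * p = cnj p" and c: "cmod c = 1"
    and maps: "mobius \<eta> p ` \<bbbD> \<subseteq> \<bbbD>"
  shows "unitary_operator (weighted_comp (weight c p) (mobius \<eta> p))"
    "symmetric_wrt J (weighted_comp (weight c p) (mobius \<eta> p))"
proof -
  let ?T = "weighted_comp (weight c p) (mobius \<eta> p)"
  let ?S = "weighted_comp (weight (cnj c) (cnj p)) (mobius (cnj \<eta>) (cnj p))"
  have cnj: "cnj p \<in> \<bbbD>" "cmod (cnj \<eta>) = 1" "cnj \<eta> * cnj p = cnj (cnj p)" "cmod (cnj c) = 1"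
    using p \<eta> c by (simp_all flip: complex_cnj_mult)
  have maps': "mobius (cnj \<eta>) (cnj p) ` \<bbbD> \<subseteq> \<bbbD>"
    using maps unfolding mobius_cnj by (auto simp: image_subset_iff)
  note T = weighted_comp_mobius_H2[OF p \<eta>(1) c maps]
  note S = weighted_comp_mobius_H2[OF cnj(1,2,4) maps']
  \<comment> \<open>The conjugated parameters satisfy the same hypotheses, so one lemma used for
    both sets of parameters gives both orders of composition.\<close>
  have inv: "?S (?T f) = f" "?T (?S f) = f" if "f \<in> H2" for f
    using weighted_comp_cnj_inverse[OF cnj maps' that] weighted_comp_cnj_inverse[OF p \<eta> c maps that]
    by simp_all
  note unitary = weighted_comp_inverse_contractions[OF T S inv]
  show "unitary_operator ?T"
    by (rule unitary(3))
  have bounded: "bounded_operator ?T"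
    by (rule unitary(1))
  have adj: "adj ?T g = ?S g" if "g \<in> H2" for g
    by (rule unitary(2)) (use that in auto)
  have "J (adj ?T (J f)) = ?T f" if "f \<in> H2" for f
    using adj[OF J_in_H2[OF that]]
    by (auto simp: J_def weighted_comp_def fun_eq_iff mobius_cnj weight_cnj)
  then show "symmetric_wrt J ?T"
    by (simp add: symmetric_wrt_def conjugation_J bounded)
qed

subsection \<open>Necessity\<close>

text \<open>Both sides of the adjoint relation evaluate to \<open>\<psi> w * f (\<phi> w)\<close> by
  the reproducing property.\<close>

lemma adj_weighted_comp_kernel:
  assumes "bounded_operator (weighted_comp \<psi> \<phi>)" "\<phi> ` \<bbbD> \<subseteq> \<bbbD>" "w \<in> \<bbbD>"
  shows "adj (weighted_comp \<psi> \<phi>) (kernel w) = (\<lambda>z. cnj (\<psi> w) * kernel (\<phi> w) z)"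
proof (rule adj_eqI)
  have \<phi>w: "\<phi> w \<in> \<bbbD>"
    using assms(2,3) by blast
  then show "(\<lambda>z. cnj (\<psi> w) * kernel (\<phi> w) z) \<in> H2"
    by (intro H2_cmult kernel_in_H2)
  fix f assume f: "f \<in> H2"
  then have "weighted_comp \<psi> \<phi> f \<in> H2"
    using assms(1) by (simp add: bounded_operator_def)
  then show "H2_inner (weighted_comp \<psi> \<phi> f) (kernel w) = H2_inner f (\<lambda>z. cnj (\<psi> w) * kernel (\<phi> w) z)"
    using f \<phi>w assms(3)
    by (simp only: H2_inner_kernel H2_inner_cmult_right H2_imp_hardy kernel_in_H2)
      (simp add: weighted_comp_def)
qed

lemma unitary_symmetric_kernel_identities:
  assumes "\<phi> ` \<bbbD> \<subseteq> \<bbbD>"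
    and "unitary_operator (weighted_comp \<psi> \<phi>)" "symmetric_wrt J (weighted_comp \<psi> \<phi>)"
    and w: "w \<in> \<bbbD>" and z: "z \<in> \<bbbD>"
  shows "\<psi> z / (1 - w * \<phi> z) = \<psi> w / (1 - \<phi> w * z)"
    "\<psi> z * cnj (\<psi> w) / (1 - cnj (\<phi> w) * \<phi> z) = 1 / (1 - cnj w * z)"
proof -
  let ?T = "weighted_comp \<psi> \<phi>"
  have bounded: "bounded_operator ?T"
    using assms(2) by (simp add: unitary_operator_def)
  note adj = adj_weighted_comp_kernel[OF bounded assms(1)]
  have \<phi>: "\<phi> z \<in> \<bbbD>" "\<phi> w \<in> \<bbbD>"
    using assms(1) w z by blast+
  have cw: "cnj w \<in> \<bbbD>" and cz: "cnj z \<in> \<bbbD>"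
    using w z by simp_all
  \<comment> \<open>Testing symmetry on the kernel at \<open>cnj w\<close> makes \<open>J\<close>
    produce the kernel at \<open>w\<close>, where the adjoint is known.\<close>
  have "J (kernel (cnj w)) = kernel w"
    by (auto simp: J_def kernel_def)
  moreover have "J (adj ?T (J (kernel (cnj w)))) = ?T (kernel (cnj w))"
    using assms(3) kernel_in_H2[OF cw] by (simp add: symmetric_wrt_def)
  ultimately have "?T (kernel (cnj w)) z = J (adj ?T (kernel w)) z"
    by simp
  also have "\<dots> = \<psi> w / (1 - \<phi> w * z)"
    unfolding adj[OF w] using cz by (simp add: J_def kernel_def)
  finally show "\<psi> z / (1 - w * \<phi> z) = \<psi> w / (1 - \<phi> w * z)"
    using z \<phi> by (simp add: weighted_comp_def kernel_def)
  \<comment> \<open>The second identity is \<open>T T* = I\<close> applied to the kernel at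
    \<open>w\<close>.\<close>
  have "?T (adj ?T (kernel w)) z = kernel w z"
    using assms(2) kernel_in_H2[OF w] by (simp add: unitary_operator_def)
  then show "\<psi> z * cnj (\<psi> w) / (1 - cnj (\<phi> w) * \<phi> z) = 1 / (1 - cnj w * z)"
    unfolding adj[OF w] using z \<phi> by (simp add: weighted_comp_def kernel_def)
qed

lemma unitary_symmetric_formula:
  assumes maps: "\<phi> ` \<bbbD> \<subseteq> \<bbbD>"
    and op: "unitary_operator (weighted_comp \<psi> \<phi>)" "symmetric_wrt J (weighted_comp \<psi> \<phi>)"
  obtains b a k where "\<And>z. z \<in> \<bbbD> \<Longrightarrow> \<psi> z = b / (1 - a * z)"
    "\<And>z. z \<in> \<bbbD> \<Longrightarrow> \<phi> z = (a - k * z) / (1 - a * z)"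
    "a = cnj a * k" "(cmod b)\<^sup>2 = 1 - (cmod a)\<^sup>2" "a = 0 \<Longrightarrow> cmod k = 1"
proof -
  note sym = unitary_symmetric_kernel_identities(1)[OF maps op]
  note unit = unitary_symmetric_kernel_identities(2)[OF maps op]
  define a where "a = \<phi> 0"
  define b where "b = \<psi> 0"
  have in_disk: "0 \<in> \<bbbD>" "1/2 \<in> \<bbbD>" "a \<in> \<bbbD>" "\<And>z. z \<in> \<bbbD> \<Longrightarrow> \<phi> z \<in> \<bbbD>"
    using maps by (auto simp: a_def image_subset_iff)
  have nz: "1 - u * v \<noteq> 0" if "u \<in> \<bbbD>" "v \<in> \<bbbD>" for u v
    using one_minus_cnj_mult_nonzero_disk[of "cnj u" v] that by simp
  have nz': "1 - cnj u * v \<noteq> 0" if "u \<in> \<bbbD>" "v \<in> \<bbbD>" for u v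
    using one_minus_cnj_mult_nonzero_disk that .
  \<comment> \<open>The unitarity identity at \<open>w = z = 0\<close>; since \<open>a\<close> lies
    in the disk, \<open>b\<close> cannot vanish.\<close>
  have bb: "b * cnj b = 1 - cnj a * a"
    using unit[OF in_disk(1,1)] nz'[OF in_disk(3,3)] by (simp add: a_def b_def)
  then have b: "b \<noteq> 0"
    using nz'[OF in_disk(3,3)] by auto
  \<comment> \<open>The symmetry identity with \<open>w = 0\<close> already determines
    \<open>\<psi>\<close>.\<close>
  have \<psi>: "\<psi> z = b / (1 - a * z)" if "z \<in> \<bbbD>" for z
    using sym[OF in_disk(1) that] by (simp add: a_def b_def)
  \<comment> \<open>Separation of variables: away from 0,
    \<open>(a - \<phi> z * (1 - a * z)) / z\<close> does not depend on \<open>z\<close>. The form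
    without division covers \<open>z = 0\<close> too.\<close>
  have swap: "z * (a - \<phi> u * (1 - a * u)) = u * (a - \<phi> z * (1 - a * z))" if u: "u \<in> \<bbbD>" and z: "z \<in> \<bbbD>" for u z
  proof -
    have "b / ((1 - a * z) * (1 - u * \<phi> z)) = b / ((1 - a * u) * (1 - \<phi> u * z))"
      using sym[OF u z] unfolding \<psi>[OF u] \<psi>[OF z] by simp
    then have "(1 - a * z) * (1 - u * \<phi> z) = (1 - a * u) * (1 - \<phi> u * z)"
      using b nz[OF in_disk(3) z] nz[OF in_disk(3) u] nz[OF u in_disk(4)[OF z]] nz[OF in_disk(4)[OF u] z]
      by (simp add: frac_eq_eq)
    then show ?thesis
      by (simp add: algebra_simps)
  qed
  \<comment> \<open>The separation constant, read off at the point \<open>1/2\<close>.\<close>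
  define k where "k = 2 * (a - \<phi> (1/2) * (1 - a * (1/2)))"
  have num: "\<phi> z * (1 - a * z) = a - k * z" if "z \<in> \<bbbD>" for z
  proof -
    have "k * z = 2 * (z * (a - \<phi> (1/2) * (1 - a * (1/2))))"
      by (simp add: k_def)
    also have "\<dots> = a - \<phi> z * (1 - a * z)"
      unfolding swap[OF in_disk(2) that] by simp
    finally show ?thesis
      by simp
  qed
  then have \<phi>: "\<phi> z = (a - k * z) / (1 - a * z)" if "z \<in> \<bbbD>" for z
    using that nz[OF in_disk(3) that] by (simp add: eq_divide_eq)
  define h :: complex where "h = 1/2"
  have h: "h \<in> \<bbbD>" "h \<noteq> 0"
    by (simp_all add: h_def)
  \<comment> \<open>The unitarity identity with \<open>w = 0\<close> at a nonzero point
    \<open>h\<close>. Comparison with \<open>bb\<close> leaves a relation linear in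
    \<open>h\<close>, which links \<open>a\<close> and \<open>k\<close>.\<close>
  have "b / (1 - a * h) * cnj b / (1 - cnj a * \<phi> h) = 1"
    using unit[OF in_disk(1) h(1)] unfolding \<psi>[OF h(1)] a_def[symmetric] b_def[symmetric] by simp
  then have "b * cnj b = (1 - a * h) * (1 - cnj a * \<phi> h)"
    using nz[OF in_disk(3) h(1)] nz'[OF in_disk(3) in_disk(4)[OF h(1)]]
    by (simp add: divide_eq_eq mult.commute)
  also have "\<dots> = (1 - a * h) - cnj a * (\<phi> h * (1 - a * h))"
    by (simp add: algebra_simps)
  also have "\<dots> = (1 - a * h) - cnj a * (a - k * h)"
    unfolding num[OF h(1)] ..
  finally have "a * h = cnj a * k * h"
    unfolding bb by (simp add: algebra_simps)
  then have ak: "a = cnj a * k"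
    using h(2) by simp
  have "complex_of_real ((cmod b)\<^sup>2) = complex_of_real (1 - (cmod a)\<^sup>2)"
    using bb by (simp only: of_real_diff of_real_1 complex_norm_square mult.commute)
  then have b_norm: "(cmod b)\<^sup>2 = 1 - (cmod a)\<^sup>2"
    by (simp only: of_real_eq_iff)
  \<comment> \<open>For \<open>a = 0\<close> the relation \<open>a = cnj a * k\<close> says nothing
    about \<open>k\<close>, so unitarity is used once more, at \<open>w = z = h\<close>.\<close>
  have "cmod k = 1" if a0: "a = 0"
  proof -
    have \<phi>h: "\<phi> h = - k * h"
      using \<phi>[OF h(1)] a0 by simp
    have "\<psi> h = b" "b * cnj b = 1"
      using \<psi>[OF h(1)] bb a0 by simp_all
    then have "1 / (1 - cnj (\<phi> h) * \<phi> h) = 1 / (1 - cnj h * h)"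
      using unit[OF h(1,1)] by simp
    then have "1 - cnj (\<phi> h) * \<phi> h = 1 - cnj h * h"
      by (metis div_by_1 divide_divide_eq_right mult_1)
    then have "cnj k * k = 1"
      unfolding \<phi>h by (simp add: h_def)
    then have "(cmod k)\<^sup>2 = 1"
      by (metis complex_norm_square mult.commute of_real_eq_1_iff)
    then show ?thesis
      using norm_ge_zero[of k] by (simp add: power2_eq_1_iff)
  qed
  with \<psi> \<phi> ak b_norm show thesis
    by (rule that)
qed

theorem proposition2p1:
  fixes \<phi> \<psi> :: "complex \<Rightarrow> complex"
  assumes "\<phi> holomorphic_on \<bbbD>"
    and "\<phi> ` \<bbbD> \<subseteq> \<bbbD>"
    and "\<psi> holomorphic_on \<bbbD>"
  shows "unitary_operator (weighted_comp \<psi> \<phi>) \<and> symmetric_wrt J (weighted_comp \<psi> \<phi>) \<longleftrightarrow>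
    (\<exists>p c. p \<in> \<bbbD> - {0} \<and> cmod c = 1 \<and>
       (\<forall>z\<in>\<bbbD>. \<psi> z = c * (complex_of_real (sqrt (1 - (cmod p)\<^sup>2)) / (1 - cnj p * z))) \<and>
       (\<forall>z\<in>\<bbbD>. \<phi> z = cnj p / p * ((p - z) / (1 - cnj p * z)))) \<or>
    (\<exists>\<mu> l. cmod \<mu> = 1 \<and> cmod l = 1 \<and>
       (\<forall>z\<in>\<bbbD>. \<psi> z = \<mu>) \<and>
       (\<forall>z\<in>\<bbbD>. \<phi> z = l * z))"
    (is "?lhs \<longleftrightarrow> ?automorphism \<or> ?rotation")
proof
  assume ?lhs
  then have "unitary_operator (weighted_comp \<psi> \<phi>)" "symmetric_wrt J (weighted_comp \<psi> \<phi>)"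
    by auto
  from unitary_symmetric_formula[OF assms(2) this] obtain b a k
    where \<psi>: "\<And>z. z \<in> \<bbbD> \<Longrightarrow> \<psi> z = b / (1 - a * z)"
      and \<phi>: "\<And>z. z \<in> \<bbbD> \<Longrightarrow> \<phi> z = (a - k * z) / (1 - a * z)"
      and k: "a = cnj a * k" and norm: "(cmod b)\<^sup>2 = 1 - (cmod a)\<^sup>2"
      and k0: "a = 0 \<Longrightarrow> cmod k = 1"
    by blast
  show "?automorphism \<or> ?rotation"
  proof (cases "a = 0")
    case True
    have "cmod b = 1"
      using norm norm_ge_zero[of b] True by (simp add: power2_eq_1_iff)
    moreover have "\<psi> z = b" "\<phi> z = - k * z" if "z \<in> \<bbbD>" for z
      using \<psi>[OF that] \<phi>[OF that] True by simp_all
    moreover have "cmod (- k) = 1"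
      using k0[OF True] by simp
    ultimately have ?rotation
      by blast
    then show ?thesis ..
  next
    case False
    \<comment> \<open>Matching the denominator \<open>1 - a * z\<close> with
      \<open>1 - cnj p * z\<close> forces this choice; then \<open>k = cnj p / p\<close> and
      \<open>c = b / s\<close>.\<close>
    define p where "p = cnj a"
    have p0: "p \<noteq> 0" and a: "a = cnj p"
      using False by (simp_all add: p_def)
    have "\<phi> 0 = a"
      using \<phi>[of 0] by simp
    moreover have "\<phi> 0 \<in> \<bbbD>"
      using assms(2) by (simp add: image_subset_iff)
    ultimately have p: "p \<in> \<bbbD>"
      by (simp add: p_def)
    have k_eq: "k = cnj p / p"
      using k p0 by (simp add: a eq_divide_eq mult.commute)
    define s where "s = sqrt (1 - (cmod p)\<^sup>2)"
    have "(cmod p)\<^sup>2 < 1"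
      using p by (simp add: power_less_one_iff)
    then have s: "s > 0"
      by (simp add: s_def)
    have "cmod b = s"
      unfolding s_def by (rule real_sqrt_unique[symmetric]) (simp_all add: norm p_def)
    then have "cmod (b / s) = 1"
      using s by (simp add: norm_divide)
    moreover have "\<psi> z = b / s * (s / (1 - cnj p * z))" if "z \<in> \<bbbD>" for z
      using \<psi>[OF that] s by (simp add: a)
    moreover have "\<phi> z = cnj p / p * ((p - z) / (1 - cnj p * z))" if "z \<in> \<bbbD>" for z
    proof -
      have "cnj p - cnj p / p * z = cnj p / p * (p - z)"
        using p0 by (simp add: right_diff_distrib)
      then show ?thesis
        unfolding \<phi>[OF that] k_eq a by simp
    qed
    moreover have "p \<in> \<bbbD> - {0}"
      using p p0 by simp
    ultimately have ?automorphism
      unfolding s_def by blast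
    then show ?thesis ..
  qed
next
  \<comment> \<open>One claim serves both cases: the first uses \<open>\<eta> = cnj p / p\<close>,
    the second \<open>p = 0\<close> and \<open>\<eta> = - l\<close>, the sign coming from
    \<open>p - z\<close>.\<close>
  have sufficient: ?lhs
    if "p \<in> \<bbbD>" "cmod \<eta> = 1" "\<eta> * p = cnj p" "cmod c = 1"
      "\<And>z. z \<in> \<bbbD> \<Longrightarrow> \<psi> z = weight c p z" "\<And>z. z \<in> \<bbbD> \<Longrightarrow> \<phi> z = mobius \<eta> p z" for p \<eta> c
  proof -
    \<comment> \<open>The automorphism agrees with \<open>\<phi>\<close> on the disk and inherits
      the self-map property from it.\<close>
    have "mobius \<eta> p ` \<bbbD> \<subseteq> \<bbbD>"
      using assms(2) that(6) by (simp add: image_subset_iff)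
    then show ?thesis
      using weighted_comp_mobius_unitary_symmetric[OF that(1-4)] weighted_comp_cong[of \<psi> _ \<phi>, OF that(5,6)]
      by simp
  qed
  assume "?automorphism \<or> ?rotation"
  then show ?lhs
  proof
    assume ?automorphism
    then obtain p c where pc: "p \<in> \<bbbD>" "p \<noteq> 0" "cmod c = 1"
      "\<And>z. z \<in> \<bbbD> \<Longrightarrow> \<psi> z = weight c p z" "\<And>z. z \<in> \<bbbD> \<Longrightarrow> \<phi> z = mobius (cnj p / p) p z"
      unfolding weight_def mobius_def by blast
    show ?lhs
      by (rule sufficient[of p "cnj p / p" c]) (use pc in \<open>simp_all add: norm_divide\<close>)
  next
    assume ?rotation
    then obtain \<mu> l where "cmod \<mu> = 1" "cmod l = 1" "\<And>z. z \<in> \<bbbD> \<Longrightarrow> \<psi> z = \<mu>"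
      "\<And>z. z \<in> \<bbbD> \<Longrightarrow> \<phi> z = l * z"
      by blast
    then show ?lhs
      by (intro sufficient[of 0 "- l" \<mu>]) (simp_all add: weight_def mobius_def)
  qed
qed

end
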